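(* Let $G$ be a $p\times k$ complex matrix and $V$ an $n\times p$ complex matrix, with $V$ scaled so that $\|Ve_i\|_2=1$ for $i=1,\dots,p$, where $e_i$ is the $i$-th vector of the canonical basis. Then the following bounds hold: (i) if $p\le kn$, then $\|(G\odot^T V^T)^\dagger\|_2\le\sigma_p(G)^{-1}\kappa_2(V)$; (ii) if $p\le k$, then $\|(G\odot^T V^T)^\dagger\|_2\le\sigma_p(G)^{-1}$; where $\kappa_2(V)=\sigma_1(V)/\sigma_p(V)$ is the condition number of $V$.
   Context: The Khatri-Rao transpose product $A\odot^T B$ of a $p\times k$ matrix $A$ and a $p\times n$ matrix $B$ is the $p\times kn$ matrix whose $i$-th row is the Kronecker product of the $i$-th row of $A$ with the $i$-th row of $B$. Here $T$ is transposition without conjugation, $\dagger$ is the Moore-Penrose pseudoinverse, $\|\cdot\|_2$ is the spectral norm for matrices and the Euclidean norm for vectors, and $\sigma_1\ge\sigma_2\ge\cdots$ are singular values in non-increasing order, with $\sigma_p$ of a matrix equal to $0$ if $p$ exceeds its smaller dimension. It may happen that $\kappa_2(V)=\infty$ (when $\sigma_p(V)=0$) or $\sigma_p(G)=0$; in these cases the corresponding right-hand side is read as $+\infty$. *)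

theory Defs
  imports "HOL-Analysis.Analysis" "HOL-Computational_Algebra.Polynomial"
begin

text \<open>
  An m-by-n complex matrix is an element of type \<open>complex^'n^'m\<close>, with \<open>m = CARD('m)\<close> and
  \<open>n = CARD('n)\<close>.
\<close>

definition cadjoint :: "complex^'n^'m \<Rightarrow> complex^'m^'n" where
  "cadjoint A = (\<chi> i j. cnj (A $ j $ i))"

text \<open>The norm of type \<open>complex^'n\<close> is the Euclidean one, so this is the spectral norm.\<close>

definition spectral_norm :: "complex^'n^'m \<Rightarrow> real" where
  "spectral_norm A = onorm (\<lambda>x. A *v x)"

definition charpoly :: "complex^'n^'n \<Rightarrow> complex poly" where
  "charpoly A = det (\<chi> i j. (if i = j then [:0, 1:] else 0) - [:A $ i $ j:])"

text \<open>
  The square roots of the eigenvalues of \<open>A\<^sup>* A\<close>, repeated according to multiplicity, in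
  non-increasing order. The eigenvalues are nonnegative reals, so \<open>Re\<close> loses nothing.
  The list has \<open>CARD('n)\<close> entries; those beyond the smaller dimension of \<open>A\<close> are zero.
\<close>

definition singular_values :: "complex^'n^'m \<Rightarrow> real list" where
  "singular_values A =
     rev (sorted_list_of_multiset
       (image_mset (\<lambda>z. sqrt (Re z)) (proots (charpoly (cadjoint A ** A)))))"

text \<open>The index \<open>i\<close> of \<open>singval A i\<close> starts at 1.\<close>

definition singval :: "complex^'n^'m \<Rightarrow> nat \<Rightarrow> real" where
  "singval A i =
     (if 1 \<le> i \<and> i \<le> min CARD('m) CARD('n) then singular_values A ! (i - 1) else 0)"

definition cond2 :: "complex^'p^'n \<Rightarrow> ereal" where
  "cond2 V =
     (if singval V CARD('p) = 0 then \<infinity> else ereal (singval V 1 / singval V CARD('p)))"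

definition is_pseudoinverse :: "complex^'n^'m \<Rightarrow> complex^'m^'n \<Rightarrow> bool" where
  "is_pseudoinverse A X \<longleftrightarrow>
     A ** X ** A = A \<and> X ** A ** X = X \<and>
     cadjoint (A ** X) = A ** X \<and> cadjoint (X ** A) = X ** A"

definition pseudoinverse :: "complex^'n^'m \<Rightarrow> complex^'m^'n" where
  "pseudoinverse A = (THE X. is_pseudoinverse A X)"

text \<open>
  The \<open>kn\<close> entries of a Kronecker product of vectors of lengths \<open>k\<close> and \<open>n\<close> are indexed by pairs;
  the usual position \<open>(a - 1) n + b\<close> corresponds to the pair \<open>(a, b)\<close>.
\<close>

definition kronecker_vec :: "complex^'k \<Rightarrow> complex^'n \<Rightarrow> complex^('k \<times> 'n)" where
  "kronecker_vec x y = (\<chi> q. x $ fst q * y $ snd q)"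

definition khatri_rao_transpose ::
  "complex^'k^'p \<Rightarrow> complex^'n^'p \<Rightarrow> complex^('k \<times> 'n)^'p"  (infixl "\<odot>\<^sup>T" 70) where
  "A \<odot>\<^sup>T B = (\<chi> i. kronecker_vec (row i A) (row i B))"

end

theory Submission
  imports Defs "HOL-Computational_Algebra.Fundamental_Theorem_Algebra"
begin

text \<open>
  Let \<open>M = G \<odot>\<^sup>T V\<^sup>T\<close>, let \<open>\<sigma> = \<sigma>\<^sub>p(G) > 0\<close> and let \<open>V\<^sub>b\<close> be the rows of \<open>V\<close>. The entries of
  \<open>M\<^sup>* x\<close> are those of the vectors \<open>G\<^sup>* w\<^sub>b\<close>, where \<open>w\<^sub>b\<close> is the entrywise product of the conjugate
  of \<open>V\<^sub>b\<close> with \<open>x\<close>. Hence the squared norm of \<open>M\<^sup>* x\<close> is at least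
  \<open>\<sigma>\<^sup>2 \<Sum>\<^sub>b \<parallel>w\<^sub>b\<parallel>\<^sup>2\<close>, which is \<open>\<sigma>\<^sup>2 \<parallel>x\<parallel>\<^sup>2\<close> because the columns of \<open>V\<close> are unit vectors. So \<open>M\<close> has
  full row rank and its pseudoinverse \<open>M\<^sup>* (M M\<^sup>*)\<^sup>-\<^sup>1\<close> has norm at most \<open>1 / \<sigma>\<close>. This is (ii), and
  (i) follows from it since \<open>\<kappa>\<^sub>2(V) \<ge> 1\<close>.

  Singular values of \<open>G\<close> are defined by roots of the characteristic polynomial of \<open>G\<^sup>* G\<close>, whereas
  the lower bound on \<open>G\<^sup>*\<close> concerns \<open>G G\<^sup>*\<close>; Sylvester's identity
  \<open>x\<^sup>p det (x - A B) = x\<^sup>k det (x - B A)\<close> matches their nonzero roots with multiplicities.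
\<close>

section \<open>Block determinants and Sylvester's identity\<close>

text \<open>In the Leibniz expansion, a permutation moving an index outside \<open>range f\<close>
  picks up a zero factor. The others are the conjugates under \<open>f\<close> of permutations of
  the smaller type: signs agree, and each index outside \<open>range f\<close> contributes a factor
  \<open>c\<close>.\<close>

lemma det_scalar_rows:
  fixes M :: "'a::comm_ring_1^'b^'b" and f :: "'c::finite \<Rightarrow> 'b::finite"
  assumes f: "inj f"
    and scalar: "\<And>i j. i \<notin> range f \<Longrightarrow> M $ i $ j = (if i = j then c else 0)"
  shows "det M = c ^ (CARD('b) - CARD('c)) * det (\<chi> i j. M $ f i $ f j)"
proof -
  let ?t = "\<lambda>p. of_int (sign p) * (\<Prod>i\<in>UNIV. M $ i $ p i)"
  let ?\<phi> = "map_permutation UNIV f"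
  have bij_f: "bij_betw f UNIV (range f)"
    using f by (simp add: bij_betw_def)
  have bij: "bij_betw ?\<phi> {p. p permutes UNIV} {p. p permutes range f}"
  proof (rule bij_betw_byWitness[where f' = "map_permutation (range f) (inv f)"])
    show "\<forall>p\<in>{p. p permutes UNIV}. map_permutation (range f) (inv f) (?\<phi> p) = p"
      using map_permutation_compose_inv[OF bij_f] f by simp
    show "\<forall>p\<in>{p. p permutes range f}. ?\<phi> (map_permutation (range f) (inv f) p) = p"
      using map_permutation_compose_inv[OF bij_betw_inv_into[OF bij_f]] by (auto simp: f_inv_into_f)
    show "?\<phi> ` {p. p permutes UNIV} \<subseteq> {p. p permutes range f}"
      using map_permutation_permutes[OF bij_f] by auto
    show "map_permutation (range f) (inv f) ` {p. p permutes range f} \<subseteq> {p. p permutes UNIV}"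
      using map_permutation_permutes[OF bij_betw_inv_into[OF bij_f]] by auto
  qed
  have term_image: "?t (?\<phi> p) = c ^ (CARD('b) - CARD('c)) *
      (of_int (sign p) * (\<Prod>i\<in>UNIV. M $ f i $ f (p i)))" if p: "p permutes UNIV" for p
  proof -
    have perm: "?\<phi> p permutes range f"
      using p by (rule map_permutation_permutes[OF bij_f])
    have "(\<Prod>i\<in>UNIV. M $ i $ ?\<phi> p i) =
        (\<Prod>i\<in>- range f. M $ i $ ?\<phi> p i) * (\<Prod>i\<in>range f. M $ i $ ?\<phi> p i)"
      by (subst prod.subset_diff[of "range f"]) (auto simp: Compl_eq_Diff_UNIV)
    also have "(\<Prod>i\<in>- range f. M $ i $ ?\<phi> p i) = (\<Prod>i\<in>- range f. c)"
      using scalar permutes_not_in[OF perm] by (intro prod.cong) auto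
    also have "\<dots> = c ^ (CARD('b) - CARD('c))"
      using f by (simp add: Compl_eq_Diff_UNIV card_Diff_subset card_image)
    also have "(\<Prod>i\<in>range f. M $ i $ ?\<phi> p i) = (\<Prod>i\<in>UNIV. M $ f i $ f (p i))"
      using f by (subst prod.reindex) (simp_all add: map_permutation_apply)
    finally show ?thesis
      using sign_map_permutation[OF f, of p] p by (simp add: mult_ac)
  qed
  have "det M = (\<Sum>p\<in>{p. p permutes range f}. ?t p)"
    unfolding det_def
  proof (rule sum.mono_neutral_right)
    show "{p. p permutes range f} \<subseteq> {p. p permutes UNIV}"
      by (auto intro: permutes_subset)
    show "\<forall>p\<in>{p. p permutes UNIV} - {p. p permutes range f}. ?t p = 0"
    proof
      fix p assume p: "p \<in> {p. p permutes (UNIV::'b set)} - {p. p permutes range f}"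
      have "\<exists>i. i \<notin> range f \<and> p i \<noteq> i"
        using p permutes_superset[of p UNIV "range f"] by auto
      then obtain i where i: "i \<notin> range f" "p i \<noteq> i"
        by blast
      then have "M $ i $ p i = 0"
        using scalar by auto
      then have "(\<Prod>i\<in>UNIV. M $ i $ p i) = 0"
        by (intro prod_zero) auto
      then show "?t p = 0"
        by simp
    qed
  qed simp
  also have "\<dots> = (\<Sum>p\<in>{p. p permutes UNIV}. ?t (?\<phi> p))"
    using sum.reindex_bij_betw[OF bij, of ?t] by simp
  finally show ?thesis
    by (simp add: term_image det_def sum_distrib_left)
qed

lemma sum_UNIV_Plus:
  "(\<Sum>x\<in>(UNIV::('a::finite + 'b::finite) set). g x) = (\<Sum>a\<in>UNIV. g (Inl a)) + (\<Sum>b\<in>UNIV. g (Inr b))"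
  by (simp add: UNIV_Plus_UNIV[symmetric] sum.Plus del: UNIV_Plus_UNIV)

definition block_matrix ::
    "'a^'k^'k \<Rightarrow> 'a^'p^'k \<Rightarrow> 'a^'k^'p \<Rightarrow> 'a^'p^'p \<Rightarrow> 'a^('k::finite + 'p::finite)^('k + 'p)" where
  "block_matrix A B C D = (\<chi> i j. case i of
     Inl a \<Rightarrow> (case j of Inl b \<Rightarrow> A $ a $ b | Inr b \<Rightarrow> B $ a $ b)
   | Inr a \<Rightarrow> (case j of Inl b \<Rightarrow> C $ a $ b | Inr b \<Rightarrow> D $ a $ b))"

lemma block_matrix_mult:
  fixes A A' :: "'a::comm_ring_1^'k^'k" and D D' :: "'a^'p^'p"
  shows "block_matrix A B C D ** block_matrix A' B' C' D' =
    block_matrix (A ** A' + B ** C') (A ** B' + B ** D') (C ** A' + D ** C') (C ** B' + D ** D')"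
  by (simp add: block_matrix_def vec_eq_iff matrix_matrix_mult_def sum_UNIV_Plus split: sum.split)

text \<open>The rows indexed by \<open>Inl\<close> are scalar, so \<open>det_scalar_rows\<close>
  applies with \<open>f = Inr\<close>.\<close>

lemma det_block_lower:
  fixes D :: "'a::comm_ring_1^'p^'p" and C :: "'a^'k^'p"
  shows "det (block_matrix (mat c) 0 C D) = c ^ CARD('k) * det D"
proof -
  have "det (block_matrix (mat c) 0 C D) = c ^ (CARD('k + 'p) - CARD('p)) *
      det (\<chi> i j. block_matrix (mat c) 0 C D $ (Inr i) $ (Inr j))"
    by (rule det_scalar_rows) (auto simp: block_matrix_def mat_def split: sum.split)
  then show ?thesis
    by (simp add: block_matrix_def)
qed

lemma det_block_upper:
  fixes A :: "'a::comm_ring_1^'k^'k" and B :: "'a^'p^'k"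
  shows "det (block_matrix A B 0 (mat c)) = c ^ CARD('p) * det A"
proof -
  have "det (block_matrix A B 0 (mat c)) = c ^ (CARD('k + 'p) - CARD('k)) *
      det (\<chi> i j. block_matrix A B 0 (mat c) $ (Inl i) $ (Inl j))"
    by (rule det_scalar_rows) (auto simp: block_matrix_def mat_def split: sum.split)
  then show ?thesis
    by (simp add: block_matrix_def)
qed

text \<open>Two block triangular factors each clear one off-diagonal block of \<open>?N\<close>;
  comparing determinants gives the identity without dividing by \<open>x\<close>.\<close>

lemma sylvester_det:
  fixes A :: "'a::comm_ring_1^'p^'k" and B :: "'a^'k^'p"
  shows "x ^ CARD('p) * det (mat x - A ** B) = x ^ CARD('k) * det (mat x - B ** A)"
proof -
  let ?N = "block_matrix (mat x) A B (mat 1)"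
  have scal: "mat x ** E = E ** mat x" for E :: "'a^'s^'r"
    by (simp add: vec_eq_iff matrix_matrix_mult_def mat_def if_distrib[of "\<lambda>z. z * _"]
        if_distrib[of "\<lambda>z. _ * z"] mult.commute cong: if_cong)
  have neg: "E ** (- F) = - (E ** F)" for E :: "'a^'s^'r" and F :: "'a^'t^'s"
    by (simp add: vec_eq_iff matrix_matrix_mult_def sum_negf)
  have "?N ** block_matrix (mat 1) 0 (- B) (mat 1) =
      block_matrix (mat x - A ** B) A 0 (mat 1)"
    by (simp add: block_matrix_mult neg)
  from arg_cong[OF this, of det] have 1: "det ?N = det (mat x - A ** B)"
    by (simp add: det_mul det_block_lower det_block_upper)
  \<comment> \<open>The block \<open>mat x\<close> makes the upper right entry
    \<open>- x A + A x\<close> cancel; its determinant is the source of the factor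
    \<open>x ^ CARD('p)\<close>.\<close>
  have "?N ** block_matrix (mat 1) (- A) 0 (mat x) =
      block_matrix (mat x) 0 B (mat x - B ** A)"
    by (simp add: block_matrix_mult neg scal)
  from arg_cong[OF this, of det] have 2: "x ^ CARD('p) * det ?N = x ^ CARD('k) * det (mat x - B ** A)"
    by (simp add: det_mul det_block_lower det_block_upper mult.commute)
  with 1 show ?thesis
    by simp
qed

section \<open>Characteristic polynomials and their roots\<close>

lemma poly_charpoly: "poly (charpoly A) z = det (mat z - A)"
  unfolding charpoly_def det_def
  by (simp add: poly_sum poly_prod mat_def if_distrib[of "\<lambda>q. poly q z"] cong: if_cong)

text \<open>Only the identity permutation reaches full degree: any other one meets an off-diagonal
  entry, which is constant.\<close>

lemma degree_charpoly:
  fixes A :: "complex^'n^'n"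
  shows "degree (charpoly A) = CARD('n)"
proof -
  let ?e = "\<lambda>i j. (if i = j then [:0, 1:] else 0) - [:A $ i $ j:]"
  let ?t = "\<lambda>p. of_int (sign p) * (\<Prod>i\<in>UNIV. ?e i (p i))"
  have sum: "charpoly A = ?t id + (\<Sum>p\<in>{p. p permutes UNIV} - {id}. ?t p)"
    unfolding charpoly_def det_def
    by (subst sum.remove[of _ id]) (simp_all add: permutes_id)
  have "degree (?t id) = (\<Sum>i\<in>(UNIV::'n set). degree (?e i i))"
    by (simp del: minus_pCons add: degree_prod_eq_sum_degree)
  then have id: "degree (?t id) = CARD('n)"
    by simp
  have "degree (?t p) < CARD('n)" if "p \<in> {p. p permutes UNIV} - {id}" for p
  proof -
    from that obtain k where k: "p k \<noteq> k"
      by (auto simp: fun_eq_iff)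
    have "degree (?t p) \<le> degree (\<Prod>i\<in>UNIV. ?e i (p i))"
      by (simp add: sign_def)
    also have "\<dots> \<le> (\<Sum>i\<in>UNIV. degree (?e i (p i)))"
      using degree_prod_sum_le[of UNIV "\<lambda>i. ?e i (p i)"] by (simp add: o_def)
    also have "\<dots> < (\<Sum>i\<in>(UNIV::'n set). 1)"
      by (rule sum_strict_mono_ex1) (auto intro!: exI[of _ k] simp: k k[symmetric])
    finally show ?thesis
      by simp
  qed
  then have "degree (\<Sum>p\<in>{p. p permutes UNIV} - {id}. ?t p) < degree (?t id)"
    unfolding id by (rule degree_sum_less) simp_all
  then have "degree (charpoly A) = degree (?t id)"
    unfolding sum by (rule degree_add_eq_left)
  then show ?thesis
    unfolding id .
qed

lemma charpoly_nonzero: "charpoly A \<noteq> 0"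
  using degree_charpoly[of A] by auto

lemma charpoly_mult_commute:
  fixes A :: "complex^'p^'k" and B :: "complex^'k^'p"
  shows "[:0, 1:] ^ CARD('p) * charpoly (A ** B) = [:0, 1:] ^ CARD('k) * charpoly (B ** A)"
proof -
  have "poly ([:0, 1:] ^ CARD('p) * charpoly (A ** B)) z =
      poly ([:0, 1:] ^ CARD('k) * charpoly (B ** A)) z" for z
    using sylvester_det[of z A B] by (simp add: poly_charpoly)
  then show ?thesis
    by (simp add: poly_eq_poly_eq_iff[symmetric] fun_eq_iff)
qed

text \<open>The powers of the indeterminate become zeros added on both sides, which avoids a case
  split on the larger dimension.\<close>

lemma proots_charpoly_mult_commute:
  fixes A :: "complex^'p^'k" and B :: "complex^'k^'p"
  shows "replicate_mset CARD('p) 0 + proots (charpoly (A ** B)) =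
         replicate_mset CARD('k) 0 + proots (charpoly (B ** A))"
  using arg_cong[OF charpoly_mult_commute[of A B], of proots]
  by (simp add: proots_mult charpoly_nonzero proots_power)

section \<open>Adjoints, Gram matrices and eigenvalues\<close>

text \<open>The library's inner product is real, so it is the real part of the Hermitian
  form.\<close>

lemma inner_complex_vec: "x \<bullet> y = Re (\<Sum>i\<in>UNIV. x $ i * cnj (y $ i))" for x y :: "complex^'n"
  by (simp add: inner_vec_def inner_complex_def)

lemma inner_cadjoint: "(A *v x) \<bullet> y = x \<bullet> (cadjoint A *v y)"
  unfolding inner_complex_vec matrix_vector_mult_def cadjoint_def
  by (simp add: sum_distrib_left sum_distrib_right mult_ac)
    (subst sum.swap, simp)

lemma cadjoint_cadjoint [simp]: "cadjoint (cadjoint A) = A"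
  by (simp add: cadjoint_def vec_eq_iff)

lemma cadjoint_mult: "cadjoint (A ** B) = cadjoint B ** cadjoint A"
  by (simp add: cadjoint_def vec_eq_iff matrix_matrix_mult_def mult.commute)

lemma cadjoint_mat_1 [simp]: "cadjoint (mat 1) = mat 1"
  by (simp add: cadjoint_def vec_eq_iff mat_def)

lemma norm_mult_gram: "(norm (A *v x))\<^sup>2 = x \<bullet> ((cadjoint A ** A) *v x)"
  by (simp add: power2_norm_eq_inner inner_cadjoint matrix_vector_mul_assoc)

lemma root_charpoly_iff:
  "poly (charpoly A) z = 0 \<longleftrightarrow> (\<exists>x. x \<noteq> 0 \<and> A *v x = z *s x)"
proof -
  have "poly (charpoly A) z = 0 \<longleftrightarrow> (\<exists>x. x \<noteq> 0 \<and> (mat z - A) *v x = 0)"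
    unfolding poly_charpoly
    by (metis invertible_det_nz invertible_left_inverse matrix_left_invertible_ker)
  moreover have "(mat z - A) *v x = z *s x - A *v x" for x
    by (simp add: vec_eq_iff matrix_vector_mult_def mat_def sum_subtractf left_diff_distrib
        if_distrib[of "\<lambda>c. c * _"] cong: if_cong)
  ultimately show ?thesis
    by (metis eq_iff_diff_eq_0)
qed

text \<open>Pairing an eigenvector \<open>x\<close> with its image gives that the squared norm of
  \<open>A *v x\<close> is \<open>Re z\<close> times that of \<open>x\<close>.\<close>

lemma charpoly_gram_root_nonneg:
  assumes "poly (charpoly (cadjoint A ** A)) z = 0"
  shows "Re z \<ge> 0"
proof -
  from assms obtain x where x: "x \<noteq> 0" "(cadjoint A ** A) *v x = z *s x"
    unfolding root_charpoly_iff by blast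
  have "x \<bullet> (z *s x) = Re z * (x \<bullet> x)"
    by (simp add: inner_vec_def inner_complex_def sum_distrib_left algebra_simps)
  then have "(norm (A *v x))\<^sup>2 = Re z * (norm x)\<^sup>2"
    unfolding norm_mult_gram x(2) by (simp add: power2_norm_eq_inner)
  then show ?thesis
    using x(1) by (metis zero_le_power2 zero_less_norm_iff zero_less_power zero_le_mult_iff not_le)
qed

section \<open>Singular values\<close>

text \<open>Multiplicities are compared on this unsorted form; the order matters only for
  \<open>singval\<close>.\<close>

abbreviation singular_mset :: "complex^'n^'m \<Rightarrow> real multiset" where
  "singular_mset A \<equiv> image_mset (\<lambda>z. sqrt (Re z)) (proots (charpoly (cadjoint A ** A)))"

lemma size_singular_mset: "size (singular_mset (A :: complex^'n^'m)) = CARD('n)"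
  by (simp add: size_proots_complex degree_charpoly)

lemma singular_mset_nonneg: "s \<in># singular_mset A \<Longrightarrow> s \<ge> 0"
  using charpoly_gram_root_nonneg by (auto simp: charpoly_nonzero)

lemma mset_singular_values: "mset (singular_values A) = singular_mset A"
  by (simp add: singular_values_def)

lemma length_singular_values: "length (singular_values (A :: complex^'n^'m)) = CARD('n)"
  using size_singular_mset[of A] by (metis mset_singular_values size_mset)

lemma singular_values_antimono:
  fixes A :: "complex^'n^'m"
  assumes "i \<le> j" "j < CARD('n)"
  shows "singular_values A ! j \<le> singular_values A ! i"
proof -
  have "sorted (rev (singular_values A))"
    by (simp add: singular_values_def)
  then show ?thesis
    using assms by (intro sorted_rev_nth_mono) (simp_all add: length_singular_values)
qed

lemma singval_nonneg: "singval A i \<ge> 0"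
proof -
  have "singular_values A ! j \<ge> 0" if "j < length (singular_values A)" for j
    using that nth_mem_mset[of j "singular_values A"]
    by (intro singular_mset_nonneg[of _ A]) (simp only: mset_singular_values)
  then show ?thesis
    by (auto simp: singval_def length_singular_values)
qed

text \<open>The witness comes from compactness: the Rayleigh quotient of \<open>A\<^sup>* A\<close> attains
  its minimum on the unit sphere, and a minimiser is an eigenvector.\<close>

lemma least_singular_value:
  fixes A :: "complex^'n^'m"
  obtains s where "s \<in># singular_mset A" "\<And>x. s * norm x \<le> norm (A *v x)"
proof -
  let ?B = "cadjoint A ** A"
  have "sphere 0 1 \<noteq> ({} :: (complex^'n) set)"
  proof -
    have "(axis undefined 1 :: complex^'n) \<in> sphere 0 1"
      by (simp add: norm_axis_1)
    then show ?thesis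
      by blast
  qed
  moreover have "continuous_on (sphere 0 1) (\<lambda>x. norm (A *v x))"
    by (intro continuous_on_norm linear_continuous_on)
      (simp add: linear_conv_bounded_linear[symmetric] matrix_vector_mul_linear)
  ultimately obtain u :: "complex^'n" where u: "norm u = 1"
    and min: "\<And>x. norm x = 1 \<Longrightarrow> norm (A *v u) \<le> norm (A *v x)"
    using continuous_attains_inf[of "sphere 0 1" "\<lambda>x. norm (A *v x)"]
    by auto
  define s where "s = norm (A *v u)"
  have lower: "s * norm x \<le> norm (A *v x)" for x
  proof (cases "x = 0")
    case False
    then have "s \<le> norm (A *v ((1 / norm x) *\<^sub>R x))"
      unfolding s_def by (intro min) simp
    also have "\<dots> = norm (A *v x) / norm x"
      by (simp add: linear_scale[OF matrix_vector_mul_linear])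
    finally show ?thesis
      using False by (simp add: field_simps)
  qed simp
  \<comment> \<open>The form \<open>H x \<bullet> x\<close> is nonnegative and vanishes at the
    minimiser \<open>u\<close>; a symmetric semidefinite form can vanish only on the kernel of
    \<open>H\<close>.\<close>
  define H where "H x = ?B *v x - s\<^sup>2 *\<^sub>R x" for x
  have lin: "linear H"
    unfolding H_def by (intro linear_compose_sub) (auto intro: linear_scale_self matrix_vector_mul_linear)
  have quad: "H x \<bullet> x = (norm (A *v x))\<^sup>2 - s\<^sup>2 * (norm x)\<^sup>2" for x
    unfolding norm_mult_gram
    by (simp add: H_def inner_diff_left inner_diff_right inner_commute power2_norm_eq_inner)
  have pos: "H x \<bullet> x \<ge> 0" for x
    using power_mono[OF lower, of x 2] by (simp add: quad power_mult_distrib s_def)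
  have sym: "H x \<bullet> y = x \<bullet> H y" for x y
    by (simp add: H_def inner_diff_left inner_diff_right inner_cadjoint cadjoint_mult)
  have zero: "H u \<bullet> u = 0"
    by (simp add: quad u s_def)
  have "H u = 0"
  proof (rule ccontr)
    assume "H u \<noteq> 0"
    define y where "y = H u"
    define a where "a = y \<bullet> y"
    define b where "b = H y \<bullet> y"
    have "a > 0" "b \<ge> 0"
      using \<open>H u \<noteq> 0\<close> pos by (simp_all add: a_def b_def y_def)
    \<comment> \<open>Moving from \<open>u\<close> along \<open>- H u\<close> gives a quadratic in
      \<open>t\<close> that vanishes at 0 with slope \<open>- 2 * a\<close>.\<close>
    have ineq: "0 \<le> - 2 * t * a + t\<^sup>2 * b" for t
      using pos[of "u - t *\<^sub>R y"] zero sym[of y u]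
      by (simp add: linear_diff[OF lin] linear_scale[OF lin] inner_diff_left inner_diff_right
          a_def b_def y_def[symmetric] power2_eq_square algebra_simps inner_commute)
    \<comment> \<open>Adding 1 keeps the denominator of \<open>t = a / c\<close> positive even if
      \<open>b = 0\<close>.\<close>
    define c where "c = b + 1"
    have "c > 0" and b: "b = c - 1"
      using \<open>b \<ge> 0\<close> by (simp_all add: c_def)
    have "- 2 * (a / c) * a + (a / c)\<^sup>2 * b = - (a\<^sup>2 * (c + 1) / c\<^sup>2)"
      using \<open>c > 0\<close> by (simp add: b field_simps power2_eq_square)
    moreover have "a\<^sup>2 * (c + 1) / c\<^sup>2 > 0"
      using \<open>a > 0\<close> \<open>c > 0\<close> by simp
    ultimately show False
      using ineq[of "a / c"] by linarith
  qed
  then have "?B *v u = complex_of_real (s\<^sup>2) *s u"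
    by (simp add: H_def vec_eq_iff scaleR_conv_of_real[where 'a = complex])
  then have "poly (charpoly ?B) (complex_of_real (s\<^sup>2)) = 0"
    unfolding root_charpoly_iff using u by (intro exI[of _ u]) auto
  then have "complex_of_real (s\<^sup>2) \<in># proots (charpoly ?B)"
    by (simp add: charpoly_nonzero del: of_real_power)
  then have "sqrt (Re (complex_of_real (s\<^sup>2))) \<in># singular_mset A"
    unfolding set_image_mset by (rule imageI)
  moreover have "sqrt (Re (complex_of_real (s\<^sup>2))) = s"
    unfolding Re_complex_of_real by (simp add: s_def)
  ultimately have "s \<in># singular_mset A"
    by (simp only:)
  with lower show ?thesis
    using that by blast
qed

lemma singular_mset_cadjoint:
  fixes A :: "complex^'n^'m"
  shows "replicate_mset CARD('m) 0 + singular_mset A =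
         replicate_mset CARD('n) 0 + singular_mset (cadjoint A)"
  using arg_cong[OF proots_charpoly_mult_commute[of "cadjoint A" A],
      of "image_mset (\<lambda>z. sqrt (Re z))"]
  by simp

text \<open>A counting argument: at least \<open>CARD('m)\<close> singular values of
  \<open>A\<close> are no smaller than the positive bound. The padding zeros lie below it, so the
  adjoint has equally many such values, and it has only \<open>CARD('m)\<close> in all.\<close>

lemma singval_le_singular_cadjoint:
  fixes A :: "complex^'n^'m"
  assumes pos: "singval A CARD('m) > 0" and s: "s \<in># singular_mset (cadjoint A)"
  shows "singval A CARD('m) \<le> s"
proof -
  let ?\<sigma> = "singval A CARD('m)"
  let ?xs = "singular_values A"
  \<comment> \<open>An index beyond the smaller dimension would give the default value 0.\<close>
  have le: "CARD('m) \<le> CARD('n)" and \<sigma>: "?\<sigma> = ?xs ! (CARD('m) - 1)"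
    using pos by (auto simp: singval_def split: if_splits)
  have no_zeros: "filter_mset (\<lambda>x. ?\<sigma> \<le> x) (replicate_mset n 0) = {#}" for n
    using pos by (induction n) simp_all
  have "?\<sigma> \<le> ?xs ! i" if "i < CARD('m)" for i
    unfolding \<sigma> using that le by (intro singular_values_antimono) linarith+
  then have "filter (\<lambda>x. ?\<sigma> \<le> x) (take CARD('m) ?xs) = take CARD('m) ?xs"
    using le by (subst filter_id_conv)
      (auto simp: in_set_conv_nth length_singular_values)
  then have "CARD('m) \<le> length (filter (\<lambda>x. ?\<sigma> \<le> x) ?xs)"
    using le append_take_drop_id[of "CARD('m)" ?xs]
    by (metis (no_types, lifting) filter_append length_append length_take length_singular_values
        min.absorb2 le_add1)
  also have "\<dots> = size (filter_mset (\<lambda>x. ?\<sigma> \<le> x) (singular_mset A))"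
    by (metis mset_filter mset_singular_values size_mset)
  also have "filter_mset (\<lambda>x. ?\<sigma> \<le> x) (singular_mset A) =
      filter_mset (\<lambda>x. ?\<sigma> \<le> x) (singular_mset (cadjoint A))"
    using arg_cong[OF singular_mset_cadjoint[of A], of "filter_mset (\<lambda>x. ?\<sigma> \<le> x)"]
    by (simp add: no_zeros)
  finally have "\<not> filter_mset (\<lambda>x. ?\<sigma> \<le> x) (singular_mset (cadjoint A)) \<subset># singular_mset (cadjoint A)"
    using mset_subset_size size_singular_mset[of "cadjoint A"] by (metis not_le)
  then have "filter_mset (\<lambda>x. ?\<sigma> \<le> x) (singular_mset (cadjoint A)) = singular_mset (cadjoint A)"
    using multiset_filter_subset[of "\<lambda>x. ?\<sigma> \<le> x"] by (metis subset_mset.le_imp_less_or_eq)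
  with s show ?thesis
    by (metis (mono_tags, lifting) mem_Collect_eq set_mset_filter)
qed

lemma singval_lower_bound:
  fixes A :: "complex^'n^'m"
  shows "singval A CARD('m) * norm x \<le> norm (cadjoint A *v x)"
proof (cases "singval A CARD('m) > 0")
  case True
  obtain s where "s \<in># singular_mset (cadjoint A)" "s * norm x \<le> norm (cadjoint A *v x)"
    by (rule least_singular_value[of "cadjoint A"]) blast
  then show ?thesis
    using singval_le_singular_cadjoint[OF True] by (meson mult_right_mono norm_ge_zero order_trans)
next
  case False
  then show ?thesis
    using singval_nonneg[of A "CARD('m)"] by (simp add: not_less)
qed

text \<open>This uniqueness resolves the \<open>THE\<close> in \<open>pseudoinverse\<close>. Both
  \<open>X ** M\<close> and \<open>Y ** M\<close> are self-adjoint and each absorbs the other on its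
  right, so taking adjoints identifies them.\<close>

lemma is_pseudoinverse_right_inverse_unique:
  fixes M :: "complex^'n^'m"
  assumes X: "is_pseudoinverse M X" "M ** X = mat 1" and Y: "is_pseudoinverse M Y"
  shows "Y = X"
proof -
  have "M ** Y = (M ** Y ** M) ** X"
    using X(2) by (metis matrix_mul_assoc matrix_mul_rid)
  then have MY: "M ** Y = mat 1"
    using X(2) Y by (simp add: is_pseudoinverse_def)
  have XM: "X ** M = (X ** M) ** (Y ** M)" and YM: "Y ** M = (Y ** M) ** (X ** M)"
    using X(2) MY by (metis matrix_mul_assoc matrix_mul_rid)+
  have "X ** M = cadjoint ((X ** M) ** (Y ** M))"
    using X(1) XM by (simp add: is_pseudoinverse_def)
  also have "\<dots> = Y ** M"
    using X(1) Y YM by (simp add: cadjoint_mult[of "X ** M"] is_pseudoinverse_def)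
  finally have "X ** M = Y ** M" .
  then show ?thesis
    using X(2) MY by (metis matrix_mul_assoc matrix_mul_rid)
qed

lemma spectral_norm_pseudoinverse_le:
  fixes M :: "complex^'n^'m"
  assumes "\<sigma> > 0" and lower: "\<And>x. \<sigma> * norm x \<le> norm (cadjoint M *v x)"
  shows "spectral_norm (pseudoinverse M) \<le> 1 / \<sigma>"
proof -
  let ?H = "M ** cadjoint M"
  have "x = 0" if "?H *v x = 0" for x
  proof -
    have "(norm (cadjoint M *v x))\<^sup>2 = 0"
      unfolding norm_mult_gram using that by simp
    then show "x = 0"
      using lower[of x] \<open>\<sigma> > 0\<close> by (simp add: mult_le_0_iff)
  qed
  then obtain W where WH: "W ** ?H = mat 1"
    using matrix_left_invertible_ker[of ?H] by blast
  then have HW: "?H ** W = mat 1"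
    by (simp add: matrix_left_right_inverse)
  \<comment> \<open>The inverse of the self-adjoint \<open>?H\<close> is self-adjoint, which
    \<open>X ** M\<close> inherits.\<close>
  have "cadjoint W = cadjoint W ** (?H ** W)"
    by (simp add: HW)
  also have "\<dots> = cadjoint (?H ** W) ** W"
    by (simp add: cadjoint_mult matrix_mul_assoc)
  finally have W: "cadjoint W = W"
    by (simp add: HW)
  define X where "X = cadjoint M ** W"
  have MX: "M ** X = mat 1"
    using HW by (simp add: X_def matrix_mul_assoc)
  have "X ** M ** X = X ** (M ** X)"
    by (simp add: matrix_mul_assoc)
  then have X: "is_pseudoinverse M X"
    unfolding is_pseudoinverse_def MX by (simp add: MX X_def cadjoint_mult W matrix_mul_assoc)
  have "pseudoinverse M = X"
    unfolding pseudoinverse_def using X MX is_pseudoinverse_right_inverse_unique by blast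
  moreover have "norm (X *v y) \<le> 1 / \<sigma> * norm y" for y
  proof -
    let ?z = "X *v y" and ?w = "W *v y"
    have z: "?z = cadjoint M *v ?w"
      by (simp add: X_def matrix_vector_mul_assoc)
    \<comment> \<open>Cauchy-Schwarz bounds this by the norms of \<open>y\<close> and
      \<open>?w\<close>; \<open>lower\<close> trades the norm of \<open>?w\<close> for that of
      \<open>?z\<close>, and one factor cancels.\<close>
    have "(norm ?z)\<^sup>2 = (M *v ?z) \<bullet> ?w"
      by (simp add: power2_norm_eq_inner inner_cadjoint flip: z)
    also have "M *v ?z = y"
      by (simp add: matrix_vector_mul_assoc MX)
    also have "y \<bullet> ?w \<le> norm y * norm ?w"
      by (rule norm_cauchy_schwarz)
    finally have "\<sigma> * (norm ?z)\<^sup>2 \<le> norm y * (\<sigma> * norm ?w)"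
      using \<open>\<sigma> > 0\<close> by (simp add: mult.left_commute)
    also have "\<dots> \<le> norm y * norm ?z"
      using lower[of ?w] by (simp add: z mult_left_mono)
    finally have "norm ?z * (\<sigma> * norm ?z) \<le> norm ?z * norm y"
      by (simp add: power2_eq_square mult_ac)
    then have "\<sigma> * norm ?z \<le> norm y"
      by (cases "norm ?z = 0") (auto simp: mult_le_cancel_left)
    then show ?thesis
      using \<open>\<sigma> > 0\<close> by (simp add: field_simps)
  qed
  ultimately show ?thesis
    unfolding spectral_norm_def by (intro onorm_le) simp
qed

section \<open>The Khatri-Rao product and the bounds\<close>

lemma khatri_rao_lower_bound:
  fixes G :: "complex^'k^'p" and V :: "complex^'p^'n"
  assumes V: "\<And>i. norm (V *v axis i 1) = 1"
    and \<sigma>: "\<sigma> \<ge> 0" "\<And>x. \<sigma> * norm x \<le> norm (cadjoint G *v x)"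
  shows "\<sigma> * norm x \<le> norm (cadjoint (G \<odot>\<^sup>T transpose V) *v x)"
proof -
  have norm_sq: "(norm y)\<^sup>2 = (\<Sum>i\<in>UNIV. (cmod (y $ i))\<^sup>2)" for y :: "complex^'r"
    by (simp add: norm_vec_def L2_set_def sum_nonneg)
  have column: "(\<Sum>b\<in>UNIV. (cmod (V $ b $ i))\<^sup>2) = 1" for i
    using V[of i] norm_sq[of "V *v axis i 1"]
    by (simp add: matrix_vector_mult_def axis_def if_distrib[of "\<lambda>c. _ * c"] cong: if_cong)
  define w where "w b = (\<chi> i. cnj (V $ b $ i) * x $ i)" for b
  have entry: "(cadjoint (G \<odot>\<^sup>T transpose V) *v x) $ (a, b) = (cadjoint G *v w b) $ a" for a b
    by (simp add: matrix_vector_mult_def cadjoint_def khatri_rao_transpose_def kronecker_vec_def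
        row_def transpose_def w_def mult_ac)
  \<comment> \<open>The unit columns allow an inner sum equal to 1 to be inserted before each entry
    of \<open>x\<close>.\<close>
  have "(\<sigma> * norm x)\<^sup>2 = \<sigma>\<^sup>2 * (\<Sum>i\<in>UNIV. (\<Sum>b\<in>UNIV. (cmod (V $ b $ i))\<^sup>2) * (cmod (x $ i))\<^sup>2)"
    by (simp add: column norm_sq power_mult_distrib)
  also have "\<dots> = (\<Sum>b\<in>UNIV. (\<sigma> * norm (w b))\<^sup>2)"
    unfolding norm_sq power_mult_distrib w_def
    by (simp add: norm_mult power_mult_distrib sum_distrib_left sum_distrib_right mult.assoc)
      (rule sum.swap)
  also have "\<dots> \<le> (\<Sum>b\<in>UNIV. (norm (cadjoint G *v w b))\<^sup>2)"
    using \<sigma> by (intro sum_mono power_mono) auto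
  also have "\<dots> = (norm (cadjoint (G \<odot>\<^sup>T transpose V) *v x))\<^sup>2"
    unfolding norm_sq by (subst sum.swap)
      (simp add: entry[symmetric] sum.cartesian_product split_beta)
  finally show ?thesis
    by (rule power2_le_imp_le) simp
qed

lemma cond2_ge_1: "cond2 V \<ge> 1"
  for V :: "complex^'p^'n"
proof -
  have "singval V CARD('p) \<le> singval V 1" if "singval V CARD('p) \<noteq> 0"
    \<comment> \<open>A nonzero value puts the index \<open>CARD('p)\<close> in range, so both sides
      are genuine list entries.\<close>
    using that by (auto simp: singval_def Suc_leI intro!: singular_values_antimono split: if_splits)
  then show ?thesis
    using singval_nonneg[of V "CARD('p)"] by (auto simp: cond2_def one_ereal_def)
qed

theorem lemma2p8:
  fixes G :: "complex^'k^'p" and V :: "complex^'p^'n"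
  assumes "\<And>i::'p. norm (V *v axis i 1) = 1"
  shows "(CARD('p) \<le> CARD('k) * CARD('n) \<longrightarrow>
            ereal (spectral_norm (pseudoinverse (G \<odot>\<^sup>T transpose V)))
              \<le> inverse (ereal (singval G CARD('p))) * cond2 V) \<and>
         (CARD('p) \<le> CARD('k) \<longrightarrow>
            ereal (spectral_norm (pseudoinverse (G \<odot>\<^sup>T transpose V)))
              \<le> inverse (ereal (singval G CARD('p))))"
proof -
  let ?\<sigma> = "singval G CARD('p)"
  have bound: "ereal (spectral_norm (pseudoinverse (G \<odot>\<^sup>T transpose V))) \<le> inverse (ereal ?\<sigma>)"
  \<comment> \<open>In \<open>ereal\<close> the inverse of 0 is infinity, matching the convention
    for a vanishing singular value.\<close>
  proof (cases "?\<sigma> = 0")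
    case False
    then have "?\<sigma> > 0"
      using singval_nonneg[of G "CARD('p)"] by linarith
    moreover have "?\<sigma> * norm x \<le> norm (cadjoint (G \<odot>\<^sup>T transpose V) *v x)" for x
      using assms singval_nonneg singval_lower_bound by (rule khatri_rao_lower_bound)
    ultimately show ?thesis
      using spectral_norm_pseudoinverse_le[of ?\<sigma> "G \<odot>\<^sup>T transpose V"]
      by (simp add: inverse_eq_divide)
  qed simp
  have "0 \<le> inverse (ereal ?\<sigma>)"
    using singval_nonneg[of G "CARD('p)"] by (cases "?\<sigma> = 0") auto
  \<comment> \<open>This weakens \<open>bound\<close> to (i); nonnegativity of the left factor keeps
    multiplication monotone even at infinity.\<close>
  then have "inverse (ereal ?\<sigma>) * 1 \<le> inverse (ereal ?\<sigma>) * cond2 V"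
    by (intro ereal_mult_left_mono cond2_ge_1)
  then show ?thesis
    using bound order_trans[OF bound] by (simp only: mult_1_right simp_thms)
qed

end
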